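(* Let $\mathcal{CB}^F_n$ be any Colonel Blotto game with favoritism and let $\kappa=(\gamma^A,\gamma^B)\in\mathbb{R}^2_{>0}$ satisfy $g^A(\gamma^A,\gamma^B)=0$ and $g^B(\gamma^A,\gamma^B)=0$. If there exists a mixed strategy of Player A whose univariate marginal distributions are $F_{A_i^\kappa}$ for all $i\in[n]$, and a mixed strategy of Player B whose univariate marginal distributions are $F_{B_i^\kappa}$ for all $i\in[n]$, then these mixed strategies constitute a (Nash) equilibrium of $\mathcal{CB}^F_n$.
   Context: **Game.** $\mathcal{CB}^F_n$ is a two-player (A and B) one-shot complete-information game with parameters: an integer $n\ge3$ (number of battlefields), budgets $0<X^A\le X^B$, $\alpha\in[0,1]$, and for each $i\in[n]=\{1,\dots,n\}$ numbers $w_i>0$, $p_i\in\mathbb{R}$, $q_i>0$. Standing assumptions: $\sum_{i}(q_iX^B-p_i)\ge X^A$, $\sum_i (X^A+p_i)/q_i\ge X^B$, and for every $i$, $q_iX^B-p_i\ge0$ and $(X^A+p_i)/q_i\ge 0$. The pure strategy set of Player $\phi\in\{A,B\}$ is $S^\phi=\{x\in\mathbb{R}^n_{\ge0}:\sum_i x_i\le X^\phi\}$; mixed strategies are probability distributions on $S^\phi$, and players randomize independently. Let $\beta(x,y)=1$ if $x>y$, $\alpha$ if $x=y$, $0$ if $x<y$. Payoffs are (expectations of) $\Pi^A=\sum_i w_i\,\beta(x_i^A,q_ix_i^B-p_i)$ and $\Pi^B=\sum_i w_i\,[1-\beta(x_i^A,q_ix_i^B-p_i)]$. **Functions $g^A,g^B$.**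 For $(\gamma^A,\gamma^B)\in\mathbb{R}^2$ let $I^+=\{j:p_j\ge0,\ \gamma^B>\frac{p_j}{q_jw_j}\}$, $I^-=\{j:p_j<0,\ \gamma^A>\frac{-p_j}{w_j}\}$, $h_i=\min\{q_iw_i\gamma^B,\ w_i\gamma^A+p_i\}$, and $$g^A(\gamma^A,\gamma^B)=\sum_{i\in I^+}\frac{h_i^2-p_i^2}{2q_iw_i}+\sum_{i\in I^-}\frac{h_i^2}{2q_iw_i}-X^B\gamma^A,$$ $$g^B(\gamma^A,\gamma^B)=\sum_{i\in I^+}\frac{(h_i-p_i)^2}{2q_iw_i}+\sum_{i\in I^-}\frac{(h_i-p_i)^2-p_i^2}{2q_iw_i}-X^A\gamma^B.$$ **Distributions $F_{A_i^\kappa},F_{B_i^\kappa}$** (cumulative distribution functions on $[0,\infty)$) for $\kappa=(\gamma^A,\gamma^B)\in\mathbb{R}^2_{>0}$: - If $p_i\ge0$ and $q_iw_i\gamma^B-p_i\le0$: $F_{A_i^\kappa}(x)=F_{B_i^\kappa}(x)=1$ for all $x\ge0$. - If $p_i\ge0$ and $0<q_iw_i\gamma^B-p_i\le w_i\gamma^A$: $F_{A_i^\kappa}(x)=\frac{p_i+x}{q_iw_i\gamma^B}$ on $[0,q_iw_i\gamma^B-p_i]$ and $1$ beyond; $F_{B_i^\kappa}(x)=1-\frac{q_i\gamma^B}{\gamma^A}+\frac{p_i}{w_i\gamma^A}$ on $[0,\frac{p_i}{q_i})$, $=1-\frac{q_i\gamma^B}{\gamma^A}+\frac{q_ix}{w_i\gamma^A}$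 on $[\frac{p_i}{q_i},w_i\gamma^B]$, and $1$ beyond. - If $p_i\ge0$ and $q_iw_i\gamma^B-p_i>w_i\gamma^A$: $F_{A_i^\kappa}(x)=1-\frac{\gamma^A}{q_i\gamma^B}+\frac{x}{q_iw_i\gamma^B}$ on $[0,w_i\gamma^A]$ and $1$ beyond; $F_{B_i^\kappa}(x)=0$ on $[0,\frac{p_i}{q_i})$, $=\frac{q_ix-p_i}{w_i\gamma^A}$ on $[\frac{p_i}{q_i},\frac{w_i\gamma^A+p_i}{q_i}]$, and $1$ beyond. - If $p_i<0$ and $w_i\gamma^A\le-p_i$: $F_{A_i^\kappa}(x)=F_{B_i^\kappa}(x)=1$ for all $x\ge0$. - If $p_i<0$ and $-p_i<w_i\gamma^A\le q_iw_i\gamma^B-p_i$: $F_{A_i^\kappa}(x)=1-\frac{\gamma^A}{q_i\gamma^B}-\frac{p_i}{q_iw_i\gamma^B}$ on $[0,-p_i)$, $=1-\frac{\gamma^A}{q_i\gamma^B}+\frac{x}{q_iw_i\gamma^B}$ on $[-p_i,w_i\gamma^A]$, and $1$ beyond; $F_{B_i^\kappa}(x)=\frac{q_ix-p_i}{w_i\gamma^A}$ on $[0,\frac{w_i\gamma^A+p_i}{q_i}]$ and $1$ beyond. - If $p_i<0$ and $w_i\gamma^A>q_iw_i\gamma^B-p_i$: $F_{A_i^\kappa}(x)=0$ on $[0,-p_i)$, $=\frac{p_i+x}{q_iw_i\gamma^B}$ on $[-p_i,q_iw_i\gamma^B-p_i]$, and $1$ beyond; $F_{B_i^\kappa}(x)=1-\frac{q_i\gamma^B}{\gamma^A}+\frac{q_ix}{w_i\gamma^A}$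 on $[0,w_i\gamma^B]$ and $1$ beyond. *)

theory Defs
  imports "HOL-Probability.Probability"
begin

text \<open>The battlefields are the elements of a finite type \<open>'n\<close>, so that \<open>n = CARD('n)\<close>
  and allocations are vectors in \<open>real ^ 'n\<close>.
  In standard notation \<open>tie\<close> is \<open>\<alpha>\<close> and \<open>weight\<close>, \<open>prealloc\<close>, \<open>effect\<close> are \<open>w\<close>, \<open>p\<close>, \<open>q\<close>;
  a negative \<open>prealloc\<close> favors player B.\<close>

record 'n blotto =
  budgetA  :: real
  budgetB  :: real
  tie      :: real
  weight   :: "'n \<Rightarrow> real"
  prealloc :: "'n \<Rightarrow> real"
  effect   :: "'n \<Rightarrow> real"

definition blotto_favoritism :: "'n::finite blotto \<Rightarrow> bool" where
  "blotto_favoritism G \<longleftrightarrow>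
     CARD('n) \<ge> 3 \<and>
     0 < budgetA G \<and> budgetA G \<le> budgetB G \<and>
     0 \<le> tie G \<and> tie G \<le> 1 \<and>
     (\<forall>i. 0 < weight G i) \<and> (\<forall>i. 0 < effect G i) \<and>
     (\<Sum>i\<in>UNIV. effect G i * budgetB G - prealloc G i) \<ge> budgetA G \<and>
     (\<Sum>i\<in>UNIV. (budgetA G + prealloc G i) / effect G i) \<ge> budgetB G \<and>
     (\<forall>i. effect G i * budgetB G - prealloc G i \<ge> 0) \<and>
     (\<forall>i. (budgetA G + prealloc G i) / effect G i \<ge> 0)"

definition pure_strategies :: "real \<Rightarrow> (real ^ 'n::finite) set" where
  "pure_strategies X = {x. (\<forall>i. 0 \<le> x $ i) \<and> (\<Sum>i\<in>UNIV. x $ i) \<le> X}"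

text \<open>All Borel probability measures on the pure strategy set.\<close>

definition mixed_strategies :: "real \<Rightarrow> (real ^ 'n::finite) measure set" where
  "mixed_strategies X = space (prob_algebra (restrict_space borel (pure_strategies X)))"

definition blotto_beta :: "real \<Rightarrow> real \<Rightarrow> real \<Rightarrow> real" where
  "blotto_beta \<alpha> x y = (if x > y then 1 else if x = y then \<alpha> else 0)"

definition pure_payoffA :: "'n::finite blotto \<Rightarrow> real ^ 'n \<Rightarrow> real ^ 'n \<Rightarrow> real" where
  "pure_payoffA G x y =
     (\<Sum>i\<in>UNIV. weight G i * blotto_beta (tie G) (x $ i) (effect G i * y $ i - prealloc G i))"

definition pure_payoffB :: "'n::finite blotto \<Rightarrow> real ^ 'n \<Rightarrow> real ^ 'n \<Rightarrow> real" where
  "pure_payoffB G x y =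
     (\<Sum>i\<in>UNIV. weight G i * (1 - blotto_beta (tie G) (x $ i) (effect G i * y $ i - prealloc G i)))"

text \<open>The product measure expresses that the players randomize independently.\<close>

definition payoffA ::
    "'n::finite blotto \<Rightarrow> (real ^ 'n) measure \<Rightarrow> (real ^ 'n) measure \<Rightarrow> real" where
  "payoffA G MA MB = (LINT z|(MA \<Otimes>\<^sub>M MB). pure_payoffA G (fst z) (snd z))"

definition payoffB ::
    "'n::finite blotto \<Rightarrow> (real ^ 'n) measure \<Rightarrow> (real ^ 'n) measure \<Rightarrow> real" where
  "payoffB G MA MB = (LINT z|(MA \<Otimes>\<^sub>M MB). pure_payoffB G (fst z) (snd z))"

definition nash_equilibrium ::
    "'n::finite blotto \<Rightarrow> (real ^ 'n) measure \<Rightarrow> (real ^ 'n) measure \<Rightarrow> bool" where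
  "nash_equilibrium G MA MB \<longleftrightarrow>
     MA \<in> mixed_strategies (budgetA G) \<and> MB \<in> mixed_strategies (budgetB G) \<and>
     (\<forall>M\<in>mixed_strategies (budgetA G). payoffA G M MB \<le> payoffA G MA MB) \<and>
     (\<forall>M\<in>mixed_strategies (budgetB G). payoffB G MA M \<le> payoffB G MA MB)"

definition I_plus :: "'n::finite blotto \<Rightarrow> real \<Rightarrow> 'n set" where
  "I_plus G \<gamma>B = {j. prealloc G j \<ge> 0 \<and> \<gamma>B > prealloc G j / (effect G j * weight G j)}"

definition I_minus :: "'n::finite blotto \<Rightarrow> real \<Rightarrow> 'n set" where
  "I_minus G \<gamma>A = {j. prealloc G j < 0 \<and> \<gamma>A > - prealloc G j / weight G j}"

definition h_fun :: "'n::finite blotto \<Rightarrow> real \<Rightarrow> real \<Rightarrow> 'n \<Rightarrow> real" where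
  "h_fun G \<gamma>A \<gamma>B i = min (effect G i * weight G i * \<gamma>B) (weight G i * \<gamma>A + prealloc G i)"

definition gA :: "'n::finite blotto \<Rightarrow> real \<Rightarrow> real \<Rightarrow> real" where
  "gA G \<gamma>A \<gamma>B =
     (\<Sum>i\<in>I_plus G \<gamma>B. ((h_fun G \<gamma>A \<gamma>B i)\<^sup>2 - (prealloc G i)\<^sup>2) / (2 * effect G i * weight G i))
     + (\<Sum>i\<in>I_minus G \<gamma>A. (h_fun G \<gamma>A \<gamma>B i)\<^sup>2 / (2 * effect G i * weight G i))
     - budgetB G * \<gamma>A"

definition gB :: "'n::finite blotto \<Rightarrow> real \<Rightarrow> real \<Rightarrow> real" where
  "gB G \<gamma>A \<gamma>B =
     (\<Sum>i\<in>I_plus G \<gamma>B. (h_fun G \<gamma>A \<gamma>B i - prealloc G i)\<^sup>2 / (2 * effect G i * weight G i))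
     + (\<Sum>i\<in>I_minus G \<gamma>A. ((h_fun G \<gamma>A \<gamma>B i - prealloc G i)\<^sup>2 - (prealloc G i)\<^sup>2) / (2 * effect G i * weight G i))
     - budgetA G * \<gamma>B"

text \<open>The distribution functions below are meaningful for arguments \<open>x \<ge> 0\<close> only.\<close>

definition FA :: "'n::finite blotto \<Rightarrow> real \<Rightarrow> real \<Rightarrow> 'n \<Rightarrow> real \<Rightarrow> real" where
  "FA G \<gamma>A \<gamma>B i x =
    (let w = weight G i; p = prealloc G i; q = effect G i in
     if p \<ge> 0 then
       if q * w * \<gamma>B - p \<le> 0 then 1
       else if q * w * \<gamma>B - p \<le> w * \<gamma>A then
         (if x \<le> q * w * \<gamma>B - p then (p + x) / (q * w * \<gamma>B) else 1)
       else
         (if x \<le> w * \<gamma>A then 1 - \<gamma>A / (q * \<gamma>B) + x / (q * w * \<gamma>B) else 1)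
     else
       if w * \<gamma>A \<le> - p then 1
       else if w * \<gamma>A \<le> q * w * \<gamma>B - p then
         (if x < - p then 1 - \<gamma>A / (q * \<gamma>B) - p / (q * w * \<gamma>B)
          else if x \<le> w * \<gamma>A then 1 - \<gamma>A / (q * \<gamma>B) + x / (q * w * \<gamma>B)
          else 1)
       else
         (if x < - p then 0
          else if x \<le> q * w * \<gamma>B - p then (p + x) / (q * w * \<gamma>B)
          else 1))"

definition FB :: "'n::finite blotto \<Rightarrow> real \<Rightarrow> real \<Rightarrow> 'n \<Rightarrow> real \<Rightarrow> real" where
  "FB G \<gamma>A \<gamma>B i x =
    (let w = weight G i; p = prealloc G i; q = effect G i in
     if p \<ge> 0 then
       if q * w * \<gamma>B - p \<le> 0 then 1
       else if q * w * \<gamma>B - p \<le> w * \<gamma>A then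
         (if x < p / q then 1 - q * \<gamma>B / \<gamma>A + p / (w * \<gamma>A)
          else if x \<le> w * \<gamma>B then 1 - q * \<gamma>B / \<gamma>A + q * x / (w * \<gamma>A)
          else 1)
       else
         (if x < p / q then 0
          else if x \<le> (w * \<gamma>A + p) / q then (q * x - p) / (w * \<gamma>A)
          else 1)
     else
       if w * \<gamma>A \<le> - p then 1
       else if w * \<gamma>A \<le> q * w * \<gamma>B - p then
         (if x \<le> (w * \<gamma>A + p) / q then (q * x - p) / (w * \<gamma>A) else 1)
       else
         (if x \<le> w * \<gamma>B then 1 - q * \<gamma>B / \<gamma>A + q * x / (w * \<gamma>A) else 1))"

definition marginal_cdf :: "(real ^ 'n::finite) measure \<Rightarrow> 'n \<Rightarrow> real \<Rightarrow> real" where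
  "marginal_cdf M i = cdf (distr M borel (\<lambda>x. x $ i))"

end

theory Submission imports Defs begin

text \<open>The game is constant-sum, so it suffices to bound the payoff of either player against the
  given strategy of the opponent by constants adding up to the total weight. Write
  \<open>u\<^sup>+ = max 0 u\<close>. Both families of distributions are truncated affine functions, which gives the
  bounds \<open>w - (h - p)\<^sup>+ / \<gamma>\<^sup>A + x / \<gamma>\<^sup>A\<close> and \<open>w - h\<^sup>+ / (q \<gamma>\<^sup>B) + y / \<gamma>\<^sup>B\<close> for the gain on a single
  battlefield. Summing over the battlefields, using the budget constraints and adding the bounds of
  the two players gives the total weight minus \<open>(g\<^sup>A + g\<^sup>B) / (\<gamma>\<^sup>A \<gamma>\<^sup>B)\<close>. Neither the supports nor
  the expected spendings of the strategies have to be computed.\<close>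

section \<open>The prescribed distribution functions as truncated affine functions\<close>

text \<open>Every increasing piece has slope \<open>1 / (q * w * \<gamma>B)\<close>, and
  \<open>h_fun\<close> fixes its offset. The inner \<open>max 0\<close> yields the flat piece for
  \<open>x < - p\<close>; the outer \<open>min 1\<close> yields everything above the support,
  including the constant cases.\<close>

lemma FA_eq_min:
  fixes G :: "'n::finite blotto"
  assumes "0 < weight G i" "0 < effect G i" "0 < \<gamma>A" "0 < \<gamma>B" "0 \<le> x"
  shows "FA G \<gamma>A \<gamma>B i x =
    min 1 (1 - (h_fun G \<gamma>A \<gamma>B i - max 0 (x + prealloc G i)) / (effect G i * weight G i * \<gamma>B))"
proof -
  define w p q where "w = weight G i" and "p = prealloc G i" and "q = effect G i"
  define C D where "C = q * w * \<gamma>B" and "D = w * \<gamma>A"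
  have C: "0 < C" and D: "0 < D" and ratio: "\<gamma>A / (q * \<gamma>B) = D / C"
    using assms by (simp_all add: w_def q_def C_def D_def)
  \<comment> \<open>Taking out the common denominator \<open>C\<close> leaves branches that are
    linear in \<open>C\<close>, \<open>D\<close>, \<open>p\<close> and \<open>x\<close>, so a plain
    case analysis of \<open>min\<close> and \<open>max\<close> suffices.\<close>
  have FA: "FA G \<gamma>A \<gamma>B i x =
      (if 0 \<le> p then
         if C - p \<le> 0 then C
         else if C - p \<le> D then (if x \<le> C - p then p + x else C)
         else (if x \<le> D then C - D + x else C)
       else
         if D \<le> - p then C
         else if D \<le> C - p then (if x < - p then C - D - p else if x \<le> D then C - D + x else C)
         else (if x < - p then 0 else if x \<le> C - p then p + x else C)) / C"
    using C unfolding FA_def Let_def w_def[symmetric] p_def[symmetric] q_def[symmetric]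
      ratio C_def[symmetric] D_def[symmetric]
    by (simp add: add_divide_distrib diff_divide_distrib)
  have h: "h_fun G \<gamma>A \<gamma>B i = min C (D + p)"
    by (simp add: h_fun_def C_def D_def w_def p_def q_def)
  have "min 1 (1 - u / C) = min C (C - u) / C" for u
    using C by (simp add: min_def field_simps)
  moreover have "min C (C - (min C (D + p) - max 0 (x + p))) =
      (if 0 \<le> p then
         if C - p \<le> 0 then C
         else if C - p \<le> D then (if x \<le> C - p then p + x else C)
         else (if x \<le> D then C - D + x else C)
       else
         if D \<le> - p then C
         else if D \<le> C - p then (if x < - p then C - D - p else if x \<le> D then C - D + x else C)
         else (if x < - p then 0 else if x \<le> C - p then p + x else C))"
    using C D \<open>0 \<le> x\<close> by (auto simp: min_def max_def)
  ultimately show ?thesis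
    unfolding FA h p_def[symmetric] w_def[symmetric] q_def[symmetric] C_def[symmetric] by simp
qed

text \<open>The mirror image of \<open>FA_eq_min\<close>, measured in \<open>s = q * y\<close>:
  increasing pieces have slope \<open>1 / (w * \<gamma>A)\<close> in \<open>s\<close>, and the flat
  piece is \<open>s < p\<close>, where Player A wins with a zero allocation.\<close>

lemma FB_eq_min:
  fixes G :: "'n::finite blotto"
  assumes "0 < weight G i" "0 < effect G i" "0 < \<gamma>A" "0 < \<gamma>B" "0 \<le> y"
  shows "FB G \<gamma>A \<gamma>B i y =
    min 1 (1 - (h_fun G \<gamma>A \<gamma>B i - max (prealloc G i) (effect G i * y)) / (weight G i * \<gamma>A))"
proof -
  define w p q where "w = weight G i" and "p = prealloc G i" and "q = effect G i"
  define C D s where "C = q * w * \<gamma>B" and "D = w * \<gamma>A" and "s = q * y"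
  have C: "0 < C" and D: "0 < D" and s: "0 \<le> s" and ratio: "q * \<gamma>B / \<gamma>A = C / D"
    using assms by (simp_all add: w_def q_def C_def D_def s_def)
  \<comment> \<open>Comparing \<open>s\<close> instead of \<open>y\<close> removes the divisions by
    \<open>q\<close> and makes all branch conditions linear.\<close>
  have less: "y < p / q \<longleftrightarrow> s < p" "y \<le> (D + p) / q \<longleftrightarrow> s \<le> D + p" "y \<le> w * \<gamma>B \<longleftrightarrow> s \<le> C"
    using assms by (auto simp: w_def q_def C_def s_def field_simps)
  have FB: "FB G \<gamma>A \<gamma>B i y =
      (if 0 \<le> p then
         if C - p \<le> 0 then D
         else if C - p \<le> D then (if s < p then D - C + p else if s \<le> C then D - C + s else D)
         else (if s < p then 0 else if s \<le> D + p then s - p else D)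
       else
         if D \<le> - p then D
         else if D \<le> C - p then (if s \<le> D + p then s - p else D)
         else (if s \<le> C then D - C + s else D)) / D"
    using D unfolding FB_def Let_def w_def[symmetric] p_def[symmetric] q_def[symmetric]
      ratio C_def[symmetric] D_def[symmetric] less s_def[symmetric]
    by (simp add: add_divide_distrib diff_divide_distrib)
  have h: "h_fun G \<gamma>A \<gamma>B i = min C (D + p)"
    by (simp add: h_fun_def C_def D_def w_def p_def q_def)
  have "min 1 (1 - u / D) = min D (D - u) / D" for u
    using D by (simp add: min_def field_simps)
  moreover have "min D (D - (min C (D + p) - max p s)) =
      (if 0 \<le> p then
         if C - p \<le> 0 then D
         else if C - p \<le> D then (if s < p then D - C + p else if s \<le> C then D - C + s else D)
         else (if s < p then 0 else if s \<le> D + p then s - p else D)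
       else
         if D \<le> - p then D
         else if D \<le> C - p then (if s \<le> D + p then s - p else D)
         else (if s \<le> C then D - C + s else D))"
    using C D s by (auto simp: min_def max_def)
  ultimately show ?thesis
    unfolding FB h p_def[symmetric] w_def[symmetric] q_def[symmetric] D_def[symmetric] s_def[symmetric]
    by simp
qed

section \<open>Bounds for the gain on a single battlefield\<close>

text \<open>The argument of \<open>FA\<close> is the allocation of Player A that ties with
  \<open>y\<close>; there the inner \<open>max\<close> of \<open>FA_eq_min\<close> equals
  \<open>q * y\<close>. The slope \<open>1 / \<gamma>B\<close> is the same on all battlefields, so
  the bounds can be summed against the budget.\<close>

lemma weight_FA_le:
  fixes G :: "'n::finite blotto"
  assumes "0 < weight G i" "0 < effect G i" "0 < \<gamma>A" "0 < \<gamma>B" "0 \<le> y"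
    and "0 \<le> effect G i * y - prealloc G i"
  shows "weight G i * FA G \<gamma>A \<gamma>B i (effect G i * y - prealloc G i)
    \<le> weight G i - max 0 (h_fun G \<gamma>A \<gamma>B i) / (effect G i * \<gamma>B) + y / \<gamma>B"
proof -
  let ?w = "weight G i" and ?q = "effect G i" and ?h = "h_fun G \<gamma>A \<gamma>B i"
  let ?F = "FA G \<gamma>A \<gamma>B i (?q * y - prealloc G i)"
  have y: "0 \<le> ?q * y"
    using assms by simp
  have F: "?F = min 1 (1 - (?h - ?q * y) / (?q * ?w * \<gamma>B))"
    using FA_eq_min[OF assms(1-4,6)] y by simp
  show ?thesis
  proof (cases "0 \<le> ?h")
    case True
    have "?w * ?F \<le> ?w * (1 - (?h - ?q * y) / (?q * ?w * \<gamma>B))"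
      using assms by (intro mult_left_mono) (simp_all add: F)
    also have "\<dots> = ?w - ?h / (?q * \<gamma>B) + y / \<gamma>B"
      using assms by (simp add: field_simps)
    finally show ?thesis
      using True by simp
  next
    \<comment> \<open>For negative \<open>h_fun\<close> the affine bound exceeds the claimed one,
      and the cap at 1 is used instead.\<close>
    case False
    have "?w * ?F \<le> ?w * 1"
      using assms by (intro mult_left_mono) (simp_all add: F)
    also have "\<dots> \<le> ?w + y / \<gamma>B"
      using assms by simp
    finally show ?thesis
      using False by simp
  qed
qed

text \<open>At the tying allocation of Player B, \<open>q * y\<close> is \<open>x + p\<close>, which
  is at least \<open>p\<close>; so the inner \<open>max\<close> of \<open>FB_eq_min\<close>
  disappears and the slope in \<open>x\<close> is \<open>1 / \<gamma>A\<close>.\<close>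

lemma weight_FB_le:
  fixes G :: "'n::finite blotto"
  assumes "0 < weight G i" "0 < effect G i" "0 < \<gamma>A" "0 < \<gamma>B" "0 \<le> x"
    and "0 \<le> (x + prealloc G i) / effect G i"
  shows "weight G i * FB G \<gamma>A \<gamma>B i ((x + prealloc G i) / effect G i)
    \<le> weight G i - max 0 (h_fun G \<gamma>A \<gamma>B i - prealloc G i) / \<gamma>A + x / \<gamma>A"
proof -
  let ?w = "weight G i" and ?p = "prealloc G i" and ?h = "h_fun G \<gamma>A \<gamma>B i"
  let ?F = "FB G \<gamma>A \<gamma>B i ((x + ?p) / effect G i)"
  have F: "?F = min 1 (1 - (?h - (x + ?p)) / (?w * \<gamma>A))"
    using FB_eq_min[OF assms(1-4,6)] assms by simp
  show ?thesis
  proof (cases "?p \<le> ?h")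
    case True
    have "?w * ?F \<le> ?w * (1 - (?h - (x + ?p)) / (?w * \<gamma>A))"
      using assms by (intro mult_left_mono) (simp_all add: F)
    also have "\<dots> = ?w - (?h - ?p) / \<gamma>A + x / \<gamma>A"
      using assms by (simp add: field_simps)
    finally show ?thesis
      using True by simp
  next
    case False
    have "?w * ?F \<le> ?w * 1"
      using assms by (intro mult_left_mono) (simp_all add: F)
    also have "\<dots> \<le> ?w + x / \<gamma>A"
      using assms by simp
    finally show ?thesis
      using False by simp
  qed
qed

section \<open>The constants of the bounds in terms of \<open>gA\<close> and
  \<open>gB\<close>\<close>

text \<open>Both sides equal \<open>max 0 h * max 0 (h - p) / (q * w)\<close>. On the right, either
  index set contributes squares adding up to \<open>2 * h * (h - p)\<close>, and \<open>i\<close>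
  lies in one of the sets exactly if \<open>h > 0\<close> and \<open>h > p\<close>.\<close>

lemma battlefield_identity:
  fixes G :: "'n::finite blotto"
  assumes "0 < weight G i" "0 < effect G i" "0 < \<gamma>A" "0 < \<gamma>B"
  shows "(max 0 (h_fun G \<gamma>A \<gamma>B i - prealloc G i) / \<gamma>A
        + max 0 (h_fun G \<gamma>A \<gamma>B i) / (effect G i * \<gamma>B) - weight G i) * (\<gamma>A * \<gamma>B) =
      (if i \<in> I_plus G \<gamma>B then ((h_fun G \<gamma>A \<gamma>B i)\<^sup>2 - (prealloc G i)\<^sup>2) / (2 * effect G i * weight G i) else 0)
    + (if i \<in> I_minus G \<gamma>A then (h_fun G \<gamma>A \<gamma>B i)\<^sup>2 / (2 * effect G i * weight G i) else 0)
    + (if i \<in> I_plus G \<gamma>B then (h_fun G \<gamma>A \<gamma>B i - prealloc G i)\<^sup>2 / (2 * effect G i * weight G i) else 0)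
    + (if i \<in> I_minus G \<gamma>A then ((h_fun G \<gamma>A \<gamma>B i - prealloc G i)\<^sup>2 - (prealloc G i)\<^sup>2) / (2 * effect G i * weight G i) else 0)"
proof -
  define w p q h where "w = weight G i" and "p = prealloc G i" and "q = effect G i"
    and "h = h_fun G \<gamma>A \<gamma>B i"
  define C D where "C = q * w * \<gamma>B" and "D = w * \<gamma>A"
  have w: "0 < w" and q: "0 < q" and C: "0 < C" and D: "0 < D"
    using assms by (simp_all add: w_def q_def C_def D_def)
  have plus: "i \<in> I_plus G \<gamma>B \<longleftrightarrow> 0 \<le> p \<and> p < C"
    using w q by (auto simp: I_plus_def C_def w_def p_def q_def field_simps)
  have minus: "i \<in> I_minus G \<gamma>A \<longleftrightarrow> p < 0 \<and> 0 < D + p"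
    using w by (auto simp: I_minus_def D_def w_def p_def field_simps)
  \<comment> \<open>Each alternative cancels \<open>C * D\<close> below: the first turns
    \<open>max 0 h * D\<close> into it, the second \<open>max 0 (h - p) * C\<close>.\<close>
  have h: "h = C \<and> C \<le> D + p \<or> D = h - p \<and> h \<le> C"
    by (auto simp: h_def h_fun_def C_def D_def w_def p_def q_def min_def)
  have "(max 0 (h - p) / \<gamma>A + max 0 h / (q * \<gamma>B) - w) * (\<gamma>A * \<gamma>B)
      = 2 * (max 0 (h - p) * C + max 0 h * D - C * D) / (2 * q * w)"
    using w q assms by (simp add: C_def D_def field_simps)
  also have "2 * (max 0 (h - p) * C + max 0 h * D - C * D) =
      (if 0 \<le> p \<and> p < C then h\<^sup>2 - p\<^sup>2 else 0) + (if p < 0 \<and> 0 < D + p then h\<^sup>2 else 0)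
    + (if 0 \<le> p \<and> p < C then (h - p)\<^sup>2 else 0) + (if p < 0 \<and> 0 < D + p then (h - p)\<^sup>2 - p\<^sup>2 else 0)"
    using h
  proof (elim disjE conjE)
    assume "h = C" "C \<le> D + p"
    then show ?thesis
      using C D by (auto simp: max_def power2_eq_square algebra_simps)
  next
    assume "D = h - p" "h \<le> C"
    then show ?thesis
      using C D by (cases "h = 0") (auto simp: max_def power2_eq_square algebra_simps)
  qed
  finally show ?thesis
    unfolding plus minus w_def[symmetric] p_def[symmetric] q_def[symmetric] h_def[symmetric]
    by (simp add: add_divide_distrib)
qed

text \<open>The two sums contain each weight twice; one copy is absorbed into \<open>?D\<close>,
  which \<open>battlefield_identity\<close> evaluates. The budget terms of \<open>gA\<close> and
  \<open>gB\<close> account for the two budget quotients.\<close>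

lemma sum_battlefield_bounds:
  fixes G :: "'n::finite blotto"
  assumes "\<And>i. 0 < weight G i" "\<And>i. 0 < effect G i" "0 < \<gamma>A" "0 < \<gamma>B"
  shows "(\<Sum>i\<in>UNIV. weight G i - max 0 (h_fun G \<gamma>A \<gamma>B i - prealloc G i) / \<gamma>A) + budgetA G / \<gamma>A
    + ((\<Sum>i\<in>UNIV. weight G i - max 0 (h_fun G \<gamma>A \<gamma>B i) / (effect G i * \<gamma>B)) + budgetB G / \<gamma>B)
    = (\<Sum>i\<in>UNIV. weight G i) - (gA G \<gamma>A \<gamma>B + gB G \<gamma>A \<gamma>B) / (\<gamma>A * \<gamma>B)"
proof -
  let ?D = "\<lambda>i. max 0 (h_fun G \<gamma>A \<gamma>B i - prealloc G i) / \<gamma>A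
        + max 0 (h_fun G \<gamma>A \<gamma>B i) / (effect G i * \<gamma>B) - weight G i"
  \<comment> \<open>Sums over both index sets become sums over all battlefields, so that the
    identity applies term by term.\<close>
  have restrict: "sum f A = (\<Sum>i\<in>UNIV. if i \<in> A then f i else 0)" for f :: "'n \<Rightarrow> real" and A
    using sum.inter_restrict[of UNIV f A] by simp
  have "(\<Sum>i\<in>UNIV. ?D i) * (\<gamma>A * \<gamma>B)
      = gA G \<gamma>A \<gamma>B + gB G \<gamma>A \<gamma>B + budgetB G * \<gamma>A + budgetA G * \<gamma>B"
    unfolding sum_distrib_right gA_def gB_def battlefield_identity[OF assms]
      restrict[of _ "I_plus G \<gamma>B"] restrict[of _ "I_minus G \<gamma>A"] sum.distrib
    by simp
  then have "(\<Sum>i\<in>UNIV. ?D i)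
      = (gA G \<gamma>A \<gamma>B + gB G \<gamma>A \<gamma>B) / (\<gamma>A * \<gamma>B) + budgetB G / \<gamma>B + budgetA G / \<gamma>A"
    using assms by (simp add: field_simps)
  then show ?thesis
    by (simp add: sum_subtractf sum.distrib)
qed

section \<open>Mixed strategies and their marginals\<close>

lemma mixed_strategiesD:
  assumes "M \<in> mixed_strategies X"
  shows "prob_space M" and "sets M = sets (restrict_space borel (pure_strategies X))"
    and "space M = pure_strategies X"
proof -
  show "prob_space M" and s: "sets M = sets (restrict_space borel (pure_strategies X))"
    using assms by (auto simp: mixed_strategies_def space_prob_algebra)
  show "space M = pure_strategies X"
    using sets_eq_imp_space_eq[OF s] by (simp add: space_restrict_space)
qed

lemma measurable_component_mixed_strategy:
  assumes "M \<in> mixed_strategies X"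
  shows "(\<lambda>x. x $ i) \<in> borel_measurable M"
  unfolding measurable_cong_sets[OF mixed_strategiesD(2)[OF assms] refl]
  by (intro measurable_restrict_space1) measurable

lemma marginal_cdf_eq_measure:
  assumes "M \<in> mixed_strategies X"
  shows "marginal_cdf M i t = measure M {x \<in> space M. x $ i \<le> t}"
  using measurable_component_mixed_strategy[OF assms, of i]
  by (auto simp: marginal_cdf_def cdf_def measure_distr vimage_def Int_def conj_commute)

text \<open>Covers negative tying allocations, where \<open>FA\<close> and \<open>FB\<close> do not
  describe the marginals.\<close>

lemma marginal_cdf_neg:
  assumes "M \<in> mixed_strategies X" and "t < 0"
  shows "marginal_cdf M i t = 0"
proof -
  have "0 \<le> x $ i" if "x \<in> space M" for x
    using that by (simp add: mixed_strategiesD(3)[OF assms(1)] pure_strategies_def)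
  then have "{x \<in> space M. x $ i \<le> t} = {}"
    using \<open>t < 0\<close> by fastforce
  then show ?thesis
    by (simp only: marginal_cdf_eq_measure[OF assms(1)] measure_empty)
qed

text \<open>Linearity of expectation: a sum of functions of single coordinates is integrated through
  the marginals alone, whatever the dependence between battlefields.\<close>

lemma integral_le_sum_marginal_cdf:
  assumes M: "M \<in> mixed_strategies X"
    and bound: "\<And>x. x \<in> pure_strategies X \<Longrightarrow> f x \<le> (\<Sum>i\<in>UNIV. w i * (if x $ i \<le> t i then 1 else 0))"
    and int: "integrable M f"
  shows "(LINT x|M. f x) \<le> (\<Sum>i\<in>UNIV. w i * marginal_cdf M i (t i))"
proof -
  interpret prob_space M
    by (rule mixed_strategiesD(1)[OF M])
  have ind: "(\<lambda>x. if x $ i \<le> t i then 1 else 0 :: real) = indicator {x. x $ i \<le> t i}" for i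
    by (auto simp: indicator_def)
  have meas: "{x \<in> space M. x $ i \<le> t i} \<in> events" for i
    using measurable_component_mixed_strategy[OF M, of i] by measurable
  have int_ind: "integrable M (indicator {x. x $ i \<le> t i} :: _ \<Rightarrow> real)" for i
    using meas[of i] by (subst integrable_indicator_iff) (auto simp: Int_def conj_commute less_top[symmetric])
  have "(LINT x|M. f x) \<le> (LINT x|M. (\<Sum>i\<in>UNIV. w i * indicator {x. x $ i \<le> t i} x))"
    using bound mixed_strategiesD(3)[OF M] int int_ind
    by (intro integral_mono) (auto simp flip: ind)
  also have "\<dots> = (\<Sum>i\<in>UNIV. w i * (LINT x|M. indicator {x. x $ i \<le> t i} x))"
    using int_ind by (subst Bochner_Integration.integral_sum) auto
  also have "\<dots> = (\<Sum>i\<in>UNIV. w i * marginal_cdf M i (t i))"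
    by (simp add: marginal_cdf_eq_measure[OF M] Int_def conj_commute)
  finally show ?thesis .
qed

section \<open>Expected payoffs: integrability, constant sum and reduction to pure
  deviations\<close>

lemma borel_measurable_pure_payoffA:
  fixes G :: "'n::finite blotto"
  assumes "M \<in> mixed_strategies X" and "N \<in> mixed_strategies Y"
  shows "(\<lambda>z. pure_payoffA G (fst z) (snd z)) \<in> borel_measurable (M \<Otimes>\<^sub>M N)"
proof -
  note [measurable] = measurable_component_mixed_strategy[OF assms(1)]
    measurable_component_mixed_strategy[OF assms(2)]
  show ?thesis
    unfolding pure_payoffA_def blotto_beta_def by measurable
qed

lemma pure_payoffA_bounds:
  fixes G :: "'n::finite blotto"
  assumes "blotto_favoritism G"
  shows "0 \<le> pure_payoffA G x y" and "pure_payoffA G x y \<le> (\<Sum>i\<in>UNIV. weight G i)"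
proof -
  have w: "0 \<le> weight G i" "0 \<le> tie G" "tie G \<le> 1" for i
    using assms by (auto simp: blotto_favoritism_def less_imp_le)
  show "0 \<le> pure_payoffA G x y"
    using w by (auto simp: pure_payoffA_def blotto_beta_def intro!: sum_nonneg)
  show "pure_payoffA G x y \<le> (\<Sum>i\<in>UNIV. weight G i)"
    unfolding pure_payoffA_def using w
    by (intro sum_mono) (auto simp: blotto_beta_def intro!: mult_left_le)
qed

lemma integrable_pure_payoffA:
  fixes G :: "'n::finite blotto"
  assumes "blotto_favoritism G" and M: "M \<in> mixed_strategies X" and N: "N \<in> mixed_strategies Y"
  shows "integrable (M \<Otimes>\<^sub>M N) (\<lambda>z. pure_payoffA G (fst z) (snd z))"
    and "x \<in> space M \<Longrightarrow> integrable N (\<lambda>y. pure_payoffA G x y)"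
    and "y \<in> space N \<Longrightarrow> integrable M (\<lambda>x. pure_payoffA G x y)"
proof -
  interpret M: prob_space M by (rule mixed_strategiesD(1)[OF M])
  interpret N: prob_space N by (rule mixed_strategiesD(1)[OF N])
  interpret pair_prob_space M N ..
  have bd: "norm (pure_payoffA G x y) \<le> (\<Sum>i\<in>UNIV. weight G i)" for x y
    using pure_payoffA_bounds[OF assms(1), of x y] by simp
  note meas = borel_measurable_pure_payoffA[OF M N, of G]
  show "integrable (M \<Otimes>\<^sub>M N) (\<lambda>z. pure_payoffA G (fst z) (snd z))"
    by (rule P.integrable_const_bound[OF _ meas]) (use bd in auto)
  show "integrable N (\<lambda>y. pure_payoffA G x y)" if "x \<in> space M"
    by (rule N.integrable_const_bound) (use bd measurable_Pair2[OF meas that] in auto)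
  show "integrable M (\<lambda>x. pure_payoffA G x y)" if "y \<in> space N"
    by (rule M.integrable_const_bound) (use bd measurable_Pair1[OF meas that] in auto)
qed

text \<open>Besides making the game constant-sum, this transfers integrability from Player A's
  payoff to Player B's.\<close>

lemma pure_payoffB_eq:
  "pure_payoffB G x y = (\<Sum>i\<in>UNIV. weight G i) - pure_payoffA G x y"
  by (simp add: pure_payoffA_def pure_payoffB_def algebra_simps sum_subtractf sum.distrib)

lemma payoffB_eq:
  fixes G :: "'n::finite blotto"
  assumes "blotto_favoritism G" and M: "M \<in> mixed_strategies X" and N: "N \<in> mixed_strategies Y"
  shows "payoffB G M N = (\<Sum>i\<in>UNIV. weight G i) - payoffA G M N"
proof -
  interpret M: prob_space M by (rule mixed_strategiesD(1)[OF M])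
  interpret N: prob_space N by (rule mixed_strategiesD(1)[OF N])
  interpret pair_prob_space M N ..
  show ?thesis
    using integrable_pure_payoffA(1)[OF assms]
    by (simp add: payoffA_def payoffB_def pure_payoffB_eq P.prob_space)
qed

text \<open>By Fubini the payoff is an average over Player A's pure allocations, so pure deviations
  are enough.\<close>

lemma payoffA_le:
  fixes G :: "'n::finite blotto"
  assumes "blotto_favoritism G" and M: "M \<in> mixed_strategies X" and N: "N \<in> mixed_strategies Y"
    and le: "\<And>x. x \<in> pure_strategies X \<Longrightarrow> (LINT y|N. pure_payoffA G x y) \<le> U"
  shows "payoffA G M N \<le> U"
proof -
  interpret M: prob_space M by (rule mixed_strategiesD(1)[OF M])
  interpret N: prob_space N by (rule mixed_strategiesD(1)[OF N])
  interpret pair_prob_space M N ..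
  note int = integrable_pure_payoffA(1)[OF assms(1) M N]
  have "payoffA G M N = (LINT x|M. LINT y|N. pure_payoffA G x y)"
    using integral_fst'[OF int] by (simp add: payoffA_def)
  also have "\<dots> \<le> (LINT x|M. U)"
    using integrable_fst'[OF int] le mixed_strategiesD(3)[OF M]
    by (intro integral_mono) auto
  finally show ?thesis
    by (simp add: M.prob_space)
qed

text \<open>Here the outer integral runs over Player B's allocations, which calls for the other
  order of integration.\<close>

lemma payoffB_le:
  fixes G :: "'n::finite blotto"
  assumes "blotto_favoritism G" and M: "M \<in> mixed_strategies X" and N: "N \<in> mixed_strategies Y"
    and le: "\<And>y. y \<in> pure_strategies Y \<Longrightarrow> (LINT x|M. pure_payoffB G x y) \<le> U"
  shows "payoffB G M N \<le> U"
proof -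
  interpret M: prob_space M by (rule mixed_strategiesD(1)[OF M])
  interpret N: prob_space N by (rule mixed_strategiesD(1)[OF N])
  interpret pair_prob_space M N ..
  have int: "integrable (M \<Otimes>\<^sub>M N) (\<lambda>(x, y). pure_payoffB G x y)"
    using integrable_pure_payoffA(1)[OF assms(1) M N]
    by (simp add: pure_payoffB_eq case_prod_beta')
  have "payoffB G M N = (LINT y|N. LINT x|M. pure_payoffB G x y)"
    using integral_snd[OF int] by (simp add: payoffB_def case_prod_beta')
  also have "\<dots> \<le> (LINT y|N. U)"
    using integrable_snd[OF int] le mixed_strategiesD(3)[OF N]
    by (intro integral_mono) auto
  finally show ?thesis
    by (simp add: N.prob_space)
qed

section \<open>Payoff bounds against the prescribed marginals\<close>

lemma payoffA_le_against_FB: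
  fixes G :: "'n::finite blotto"
  assumes G: "blotto_favoritism G" and pos: "0 < \<gamma>A" "0 < \<gamma>B"
    and M: "M \<in> mixed_strategies (budgetA G)" and N: "N \<in> mixed_strategies Y"
    and cdf: "\<And>i y. 0 \<le> y \<Longrightarrow> marginal_cdf N i y = FB G \<gamma>A \<gamma>B i y"
  shows "payoffA G M N \<le>
    (\<Sum>i\<in>UNIV. weight G i - max 0 (h_fun G \<gamma>A \<gamma>B i - prealloc G i) / \<gamma>A) + budgetA G / \<gamma>A"
proof (rule payoffA_le[OF G M N])
  fix x :: "real ^ 'n"
  assume x: "x \<in> pure_strategies (budgetA G)"
  then have x0: "0 \<le> x $ i" for i
    by (simp add: pure_strategies_def)
  have w: "0 < weight G i" and q: "0 < effect G i" and tie: "0 \<le> tie G" "tie G \<le> 1" for i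
    using G by (auto simp: blotto_favoritism_def)
  let ?h = "h_fun G \<gamma>A \<gamma>B" and ?t = "\<lambda>i. (x $ i + prealloc G i) / effect G i"
  have "(LINT y|N. pure_payoffA G x y) \<le> (\<Sum>i\<in>UNIV. weight G i * marginal_cdf N i (?t i))"
  proof (rule integral_le_sum_marginal_cdf[OF N])
    show "pure_payoffA G x y \<le> (\<Sum>i\<in>UNIV. weight G i * (if y $ i \<le> ?t i then 1 else 0))" for y
      unfolding pure_payoffA_def
    proof (intro sum_mono mult_left_mono)
      \<comment> \<open>A tie is credited in full to the deviating player, which is an upper bound
        because \<open>tie G \<le> 1\<close>.\<close>
      show "blotto_beta (tie G) (x $ i) (effect G i * y $ i - prealloc G i)
          \<le> (if y $ i \<le> ?t i then 1 else 0)" for i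
        using q[of i] tie by (auto simp: blotto_beta_def field_simps)
    qed (use w in \<open>auto simp: less_imp_le\<close>)
    show "integrable N (pure_payoffA G x)"
      using integrable_pure_payoffA(2)[OF G M N] x mixed_strategiesD(3)[OF M] by simp
  qed
  also have "\<dots> \<le> (\<Sum>i\<in>UNIV. weight G i - max 0 (?h i - prealloc G i) / \<gamma>A + x $ i / \<gamma>A)"
  proof (rule sum_mono)
    fix i
    show "weight G i * marginal_cdf N i (?t i)
        \<le> weight G i - max 0 (?h i - prealloc G i) / \<gamma>A + x $ i / \<gamma>A"
    proof (cases "0 \<le> ?t i")
      case True
      then show ?thesis
        using weight_FB_le[OF w q pos x0 True] cdf[OF True] by simp
    next
      case False
      \<comment> \<open>With a negative threshold Player B wins for sure, so the left side is zero
        and only nonnegativity of the bound remains.\<close>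
      have "?h i - prealloc G i \<le> weight G i * \<gamma>A"
        by (simp add: h_fun_def)
      then have "max 0 (?h i - prealloc G i) / \<gamma>A \<le> weight G i"
        using pos w[of i] by (simp add: field_simps)
      then show ?thesis
        using False marginal_cdf_neg[OF N] x0[of i] pos by simp
    qed
  qed
  also have "\<dots> = (\<Sum>i\<in>UNIV. weight G i - max 0 (?h i - prealloc G i) / \<gamma>A)
      + (\<Sum>i\<in>UNIV. x $ i) / \<gamma>A"
    by (simp add: sum.distrib sum_divide_distrib)
  \<comment> \<open>The common slope leaves only the total spending, which the budget
    bounds.\<close>
  also have "\<dots> \<le> (\<Sum>i\<in>UNIV. weight G i - max 0 (?h i - prealloc G i) / \<gamma>A) + budgetA G / \<gamma>A"
    using x pos by (simp add: pure_strategies_def divide_right_mono)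
  finally show "(LINT y|N. pure_payoffA G x y) \<le>
      (\<Sum>i\<in>UNIV. weight G i - max 0 (?h i - prealloc G i) / \<gamma>A) + budgetA G / \<gamma>A" .
qed

lemma payoffB_le_against_FA:
  fixes G :: "'n::finite blotto"
  assumes G: "blotto_favoritism G" and pos: "0 < \<gamma>A" "0 < \<gamma>B"
    and M: "M \<in> mixed_strategies X" and N: "N \<in> mixed_strategies (budgetB G)"
    and cdf: "\<And>i x. 0 \<le> x \<Longrightarrow> marginal_cdf M i x = FA G \<gamma>A \<gamma>B i x"
  shows "payoffB G M N \<le>
    (\<Sum>i\<in>UNIV. weight G i - max 0 (h_fun G \<gamma>A \<gamma>B i) / (effect G i * \<gamma>B)) + budgetB G / \<gamma>B"
proof (rule payoffB_le[OF G M N])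
  fix y :: "real ^ 'n"
  assume y: "y \<in> pure_strategies (budgetB G)"
  then have y0: "0 \<le> y $ i" for i
    by (simp add: pure_strategies_def)
  have w: "0 < weight G i" and q: "0 < effect G i" and tie: "0 \<le> tie G" "tie G \<le> 1" for i
    using G by (auto simp: blotto_favoritism_def)
  interpret M: prob_space M by (rule mixed_strategiesD(1)[OF M])
  let ?h = "h_fun G \<gamma>A \<gamma>B" and ?t = "\<lambda>i. effect G i * y $ i - prealloc G i"
  have "(LINT x|M. pure_payoffB G x y) \<le> (\<Sum>i\<in>UNIV. weight G i * marginal_cdf M i (?t i))"
  proof (rule integral_le_sum_marginal_cdf[OF M])
    show "pure_payoffB G x y \<le> (\<Sum>i\<in>UNIV. weight G i * (if x $ i \<le> ?t i then 1 else 0))" for x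
      unfolding pure_payoffB_def
    proof (intro sum_mono mult_left_mono)
      \<comment> \<open>Ties now count in full for Player B, by
        \<open>0 \<le> tie G\<close>.\<close>
      show "1 - blotto_beta (tie G) (x $ i) (?t i) \<le> (if x $ i \<le> ?t i then 1 else 0)" for i
        using tie by (auto simp: blotto_beta_def)
    qed (use w in \<open>auto simp: less_imp_le\<close>)
    show "integrable M (\<lambda>x. pure_payoffB G x y)"
      using integrable_pure_payoffA(3)[OF G M N] y mixed_strategiesD(3)[OF N]
      by (simp add: pure_payoffB_eq)
  qed
  also have "\<dots> \<le> (\<Sum>i\<in>UNIV. weight G i - max 0 (?h i) / (effect G i * \<gamma>B) + y $ i / \<gamma>B)"
  proof (rule sum_mono)
    fix i
    show "weight G i * marginal_cdf M i (?t i)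
        \<le> weight G i - max 0 (?h i) / (effect G i * \<gamma>B) + y $ i / \<gamma>B"
    proof (cases "0 \<le> ?t i")
      case True
      then show ?thesis
        using weight_FA_le[OF w q pos y0 True] cdf[OF True] by simp
    next
      case False
      \<comment> \<open>A negative threshold means a sure win for Player A; again the bound only has
        to be nonnegative.\<close>
      have "?h i \<le> effect G i * weight G i * \<gamma>B"
        by (simp add: h_fun_def)
      then have "max 0 (?h i) / (effect G i * \<gamma>B) \<le> weight G i"
        using pos w[of i] q[of i] by (simp add: field_simps)
      then show ?thesis
        using False marginal_cdf_neg[OF M] y0[of i] pos by simp
    qed
  qed
  also have "\<dots> = (\<Sum>i\<in>UNIV. weight G i - max 0 (?h i) / (effect G i * \<gamma>B))
      + (\<Sum>i\<in>UNIV. y $ i) / \<gamma>B"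
    by (simp add: sum.distrib sum_divide_distrib)
  also have "\<dots> \<le> (\<Sum>i\<in>UNIV. weight G i - max 0 (?h i) / (effect G i * \<gamma>B)) + budgetB G / \<gamma>B"
    using y pos by (simp add: pure_strategies_def divide_right_mono)
  finally show "(LINT x|M. pure_payoffB G x y) \<le>
      (\<Sum>i\<in>UNIV. weight G i - max 0 (?h i) / (effect G i * \<gamma>B)) + budgetB G / \<gamma>B" .
qed

section \<open>From complementary payoff bounds to equilibrium\<close>

theorem corollary5p1:
  fixes G :: "'n::finite blotto" and \<gamma>A \<gamma>B :: real
    and MA MB :: "(real ^ 'n) measure"
  assumes "blotto_favoritism G"
    and "\<gamma>A > 0" and "\<gamma>B > 0"
    and "gA G \<gamma>A \<gamma>B = 0" and "gB G \<gamma>A \<gamma>B = 0"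
    and "MA \<in> mixed_strategies (budgetA G)"
    and "\<And>i x. 0 \<le> x \<Longrightarrow> marginal_cdf MA i x = FA G \<gamma>A \<gamma>B i x"
    and "MB \<in> mixed_strategies (budgetB G)"
    and "\<And>i x. 0 \<le> x \<Longrightarrow> marginal_cdf MB i x = FB G \<gamma>A \<gamma>B i x"
  shows "nash_equilibrium G MA MB"
proof -
  note G = assms(1) and pos = assms(2,3) and MA = assms(6) and MB = assms(8)
  define W where "W = (\<Sum>i\<in>UNIV. weight G i)"
  define UA where "UA = (\<Sum>i\<in>UNIV. weight G i
    - max 0 (h_fun G \<gamma>A \<gamma>B i - prealloc G i) / \<gamma>A) + budgetA G / \<gamma>A"
  define UB where "UB = (\<Sum>i\<in>UNIV. weight G i
    - max 0 (h_fun G \<gamma>A \<gamma>B i) / (effect G i * \<gamma>B)) + budgetB G / \<gamma>B"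
  have "UA + UB = W"
    using sum_battlefield_bounds[of G \<gamma>A \<gamma>B] G pos assms(4,5)
    by (simp add: UA_def UB_def W_def blotto_favoritism_def)
  moreover have "payoffA G M MB \<le> UA" if "M \<in> mixed_strategies (budgetA G)" for M
    unfolding UA_def by (rule payoffA_le_against_FB[OF G pos that MB assms(9)])
  moreover have "payoffB G MA M \<le> UB" if "M \<in> mixed_strategies (budgetB G)" for M
    unfolding UB_def by (rule payoffB_le_against_FA[OF G pos MA that assms(7)])
  moreover have "payoffB G MA MB = W - payoffA G MA MB"
    unfolding W_def by (rule payoffB_eq[OF G MA MB])
  \<comment> \<open>Since the payoffs at \<open>MA\<close>, \<open>MB\<close> add up to
    \<open>W = UA + UB\<close> and respect both bounds, they attain both; hence no deviation is
    profitable.\<close>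
  ultimately show ?thesis
    using MA MB unfolding nash_equilibrium_def by fastforce
qed

end
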